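(* Suppose $X$ is a separable Banach space and $\Omega$ is a metric space with $\Omega=\bigcup_{m=1}^\infty \Omega_m$, where $\Omega_m\in\mathcal{B}(\Omega)$ for every $m\in\mathbb{N}$. Let $\mathcal{D}$ be an inclusion-closed collection of families of nonempty subsets of $X$, and let $\Phi$ be a multivalued non-autonomous cocycle on $X$ over $(\Omega,\mathcal{B}(\Omega),P,\{\theta_t\}_{t\in\mathbb{R}})$. Suppose further: (i) $\Phi$ is $\mathcal{D}$-pullback asymptotically compact in $X$. (ii) $\Phi(t,\tau,\omega,\cdot): X\to 2^X$ is upper semicontinuous for each $t\in\mathbb{R}^+$, $\tau\in\mathbb{R}$ and $\omega\in\Omega$. (iii) $\Phi$ has a closed $\mathcal{D}$-pullback absorbing set $K\in\mathcal{D}$. (iv) The mapping $\omega\mapsto\Phi(t,\tau,\omega,K(\tau,\omega))$ from $\Omega_m$ to $2^X$ is weakly upper semicontinuous for every $m\in\mathbb{N}$, $t\in\mathbb{R}^+$ and $\tau\in\mathbb{R}$. Then $\Phi$ has a unique $\mathcal{D}$-pullback attractor $\mathcal{A}=\Omega(K)$ in $\mathcal{D}$, where $\Omega(K)$ is the $\Omega$-limit set of $K$ under $\Phi$. If, in addition, both $\Phi$ and $K$ are $T$-periodic, then so is the attractor $\mathcal{A}$.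
   Context: $2^X$ is the collection of all subsets of $X$, $\mathbb{R}^+=[0,\infty)$, $d$ is the metric of $X$, and $d(A,B)=\sup_{a\in A}\inf_{b\in B}d(a,b)$ is the Hausdorff semi-distance between subsets. For a set $A\subseteq X$, $\Phi(t,\tau,\omega,A)=\bigcup_{x\in A}\Phi(t,\tau,\omega,x)$. Metric dynamical system: $(\Omega,\mathcal{F},P,\{\theta_t\}_{t\in\mathbb{R}})$ where $(\Omega,\mathcal{F},P)$ is a probability space and $\theta:\mathbb{R}\times\Omega\to\Omega$ is a measurable, $P$-preserving group of transformations of $\Omega$ ($\theta_0=\mathrm{id}$, $\theta_{t+s}=\theta_t\circ\theta_s$). Here $\mathcal{F}=\mathcal{B}(\Omega)$, the Borel $\sigma$-algebra; completeness of $P$ is not assumed. Multivalued maps: $G: Y\to 2^X$ on a measurable space $Y$ is measurable if $\{y: G(y)\cap O\ne\emptyset\}$ is measurable for every open $O\subseteq X$. $G$ on a metric space $Y$ is upper semicontinuous at $y$ if for every neighborhood $\mathcal{U}$ of $G(y)$ there is $\eta>0$ with $G(y')\subseteq\mathcal{U}$ whenever $d(y',y)<\eta$. $G$ is weakly upper semicontinuous at $y_0$ if for any $y_n\to y_0$ and $x_n\in G(y_n)$ there exist $x_0\in G(y_0)$ and a subsequence $x_{n_k}\rightharpoonup x_0$ weakly in $X$; it is (weakly) upper semicontinuous if it is so at every point. Multivalued non-autonomous cocycle on $X$: a map $\Phi:\mathbb{R}^+\times\mathbb{R}\times\Omega\times X\to 2^X$ with nonempty closed images such that for all $\tau\in\mathbb{R}$,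 $\omega\in\Omega$, $t,s\in\mathbb{R}^+$: $\Phi(\cdot,\tau,\cdot,\cdot):\mathbb{R}^+\times\Omega\times X\to 2^X$ is $\mathcal{B}(\mathbb{R}^+)\times\mathcal{F}\times\mathcal{B}(X)$-measurable; $\Phi(0,\tau,\omega,\cdot)$ is the identity on $X$; $\Phi(t+s,\tau,\omega,\cdot)=\Phi(t,\tau+s,\theta_s\omega,\cdot)\circ\Phi(s,\tau,\omega,\cdot)$. $\Phi$ is $T$-periodic ($T>0$) if $\Phi(t,\tau+T,\omega,\cdot)=\Phi(t,\tau,\omega,\cdot)$ for all $t,\tau,\omega$. A family $B=\{B(\tau,\omega)\}$ is $T$-periodic if $B(\tau+T,\omega)=B(\tau,\omega)$ for all $\tau,\omega$. $\mathcal{D}$ is a collection of families $D=\{D(\tau,\omega):\tau\in\mathbb{R},\omega\in\Omega\}$ of nonempty subsets of $X$; it is inclusion-closed if whenever $D\in\mathcal{D}$ and $\tilde D=\{\tilde D(\tau,\omega)\}$ is a family of nonempty sets with $\tilde D(\tau,\omega)\subseteq D(\tau,\omega)$ for all $\tau,\omega$, then $\tilde D\in\mathcal{D}$. $\Omega$-limit set: $\Omega(B)(\tau,\omega)=\bigcap_{r\ge0}\overline{\bigcup_{t\ge r}\Phi(t,\tau-t,\theta_{-t}\omega,B(\tau-t,\theta_{-t}\omega))}$. $\mathcal{D}$-pullback asymptotic compactness: for all $\tau$, $\omega$, $D\in\mathcal{D}$, every sequence $x_n\in\Phi(t_n,\tau-t_n,\theta_{-t_n}\omega,D(\tau-t_n,\theta_{-t_n}\omega))$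 with $t_n\to\infty$ has a convergent subsequence in $X$. $K\in\mathcal{D}$ is a $\mathcal{D}$-pullback absorbing set if for all $\tau,\omega$ and $D\in\mathcal{D}$ there is $T=T(D,\tau,\omega)>0$ with $\Phi(t,\tau-t,\theta_{-t}\omega,D(\tau-t,\theta_{-t}\omega))\subseteq K(\tau,\omega)$ for all $t\ge T$; it is closed if each $K(\tau,\omega)$ is closed in $X$. $\mathcal{D}$-pullback attractor: a family $\mathcal{A}=\{\mathcal{A}(\tau,\omega)\}\in\mathcal{D}$ such that for all $\tau,\omega$: $\mathcal{A}(\tau,\cdot):\Omega\to2^X$ is measurable with respect to $\mathcal{F}$ and $\mathcal{A}(\tau,\omega)$ is compact; $\Phi(t,\tau,\omega,\mathcal{A}(\tau,\omega))=\mathcal{A}(\tau+t,\theta_t\omega)$ for all $t\ge0$; and for every $D\in\mathcal{D}$, $\lim_{t\to\infty}d(\Phi(t,\tau-t,\theta_{-t}\omega,D(\tau-t,\theta_{-t}\omega)),\mathcal{A}(\tau,\omega))=0$. *)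

theory Defs
  imports "HOL-Probability.Probability"
begin

(* Omega is the whole type 'w: these definitions are meant for measures P with space P = UNIV,
   which holds in particular when sets P = sets borel. *)
definition metric_dynamical_system :: "'w measure \<Rightarrow> (real \<Rightarrow> 'w \<Rightarrow> 'w) \<Rightarrow> bool" where
  "metric_dynamical_system P \<theta> \<longleftrightarrow>
     prob_space P \<and>
     (\<lambda>(t, \<omega>). \<theta> t \<omega>) \<in> borel \<Otimes>\<^sub>M P \<rightarrow>\<^sub>M P \<and>
     (\<forall>t. distr P P (\<theta> t) = P) \<and>
     (\<forall>\<omega>. \<theta> 0 \<omega> = \<omega>) \<and>
     (\<forall>t s \<omega>. \<theta> (t + s) \<omega> = \<theta> t (\<theta> s \<omega>))"


section \<open>Multivalued maps\<close>

definition multi_measurable :: "'y measure \<Rightarrow> ('y \<Rightarrow> 'x::topological_space set) \<Rightarrow> bool" where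
  "multi_measurable M G \<longleftrightarrow>
     (\<forall>U. open U \<longrightarrow> {y \<in> space M. G y \<inter> U \<noteq> {}} \<in> sets M)"

(* U is a neighbourhood of the set G y, that is, G y is contained in the interior of U. *)
definition upper_semicontinuous :: "('y::metric_space \<Rightarrow> 'x::topological_space set) \<Rightarrow> bool" where
  "upper_semicontinuous G \<longleftrightarrow>
     (\<forall>y U. G y \<subseteq> interior U \<longrightarrow> (\<exists>\<eta>>0. \<forall>y'. dist y' y < \<eta> \<longrightarrow> G y' \<subseteq> U))"

definition weakly_tendsto :: "(nat \<Rightarrow> 'x::real_normed_vector) \<Rightarrow> 'x \<Rightarrow> bool" where
  "weakly_tendsto x x0 \<longleftrightarrow>
     (\<forall>f :: 'x \<Rightarrow> real. bounded_linear f \<longrightarrow> (\<lambda>n. f (x n)) \<longlonglongrightarrow> f x0)"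

(* The domain is the metric subspace S: both the sequence and its limit range over S only. *)
definition weakly_usc_on ::
    "'y::metric_space set \<Rightarrow> ('y \<Rightarrow> 'x::real_normed_vector set) \<Rightarrow> bool" where
  "weakly_usc_on S G \<longleftrightarrow>
     (\<forall>y0\<in>S. \<forall>y x. (\<forall>n. y n \<in> S) \<longrightarrow> y \<longlonglongrightarrow> y0 \<longrightarrow> (\<forall>n. x n \<in> G (y n)) \<longrightarrow>
        (\<exists>x0\<in>G y0. \<exists>r :: nat \<Rightarrow> nat. strict_mono r \<and> weakly_tendsto (x \<circ> r) x0))"

(* Valued in the extended nonnegative reals, since the supremum may be infinite. *)
definition hausdorff_semidist :: "'x::metric_space set \<Rightarrow> 'x set \<Rightarrow> ennreal" where
  "hausdorff_semidist A B = (SUP a\<in>A. INF b\<in>B. ennreal (dist a b))"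


section \<open>Multivalued non-autonomous cocycles\<close>

(* Time is of type real; only the values of a cocycle at times t >= 0 are meaningful,
   and every condition below is restricted to such times. *)
type_synonym ('w, 'x) multi_map = "real \<Rightarrow> real \<Rightarrow> 'w \<Rightarrow> 'x \<Rightarrow> 'x set"
type_synonym ('w, 'x) family = "real \<Rightarrow> 'w \<Rightarrow> 'x set"

definition multi_image ::
    "('w, 'x) multi_map \<Rightarrow> real \<Rightarrow> real \<Rightarrow> 'w \<Rightarrow> 'x set \<Rightarrow> 'x set" where
  "multi_image \<Phi> t \<tau> \<omega> A = (\<Union>x\<in>A. \<Phi> t \<tau> \<omega> x)"

definition pullback ::
    "(real \<Rightarrow> 'w \<Rightarrow> 'w) \<Rightarrow> ('w, 'x) multi_map \<Rightarrow> ('w, 'x) family \<Rightarrow> real \<Rightarrow> real \<Rightarrow> 'w \<Rightarrow> 'x set" where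
  "pullback \<theta> \<Phi> D t \<tau> \<omega> =
     multi_image \<Phi> t (\<tau> - t) (\<theta> (- t) \<omega>) (D (\<tau> - t) (\<theta> (- t) \<omega>))"

definition multivalued_cocycle ::
    "'w measure \<Rightarrow> (real \<Rightarrow> 'w \<Rightarrow> 'w) \<Rightarrow> ('w, 'x::metric_space) multi_map \<Rightarrow> bool" where
  "multivalued_cocycle P \<theta> \<Phi> \<longleftrightarrow>
     (\<forall>t\<ge>0. \<forall>\<tau>. \<forall>\<omega> x. \<Phi> t \<tau> \<omega> x \<noteq> {} \<and> closed (\<Phi> t \<tau> \<omega> x)) \<and>
     (\<forall>\<tau>. multi_measurable (restrict_space borel {0..} \<Otimes>\<^sub>M (P \<Otimes>\<^sub>M borel))
             (\<lambda>(t, \<omega>, x). \<Phi> t \<tau> \<omega> x)) \<and>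
     (\<forall>\<tau>. \<forall>\<omega> x. \<Phi> 0 \<tau> \<omega> x = {x}) \<and>
     (\<forall>t\<ge>0. \<forall>s\<ge>0. \<forall>\<tau>. \<forall>\<omega> x.
        \<Phi> (t + s) \<tau> \<omega> x = multi_image \<Phi> t (\<tau> + s) (\<theta> s \<omega>) (\<Phi> s \<tau> \<omega> x))"

definition periodic_cocycle :: "real \<Rightarrow> ('w, 'x) multi_map \<Rightarrow> bool" where
  "periodic_cocycle T \<Phi> \<longleftrightarrow> (\<forall>t\<ge>0. \<forall>\<tau> \<omega> x. \<Phi> t (\<tau> + T) \<omega> x = \<Phi> t \<tau> \<omega> x)"

definition periodic_family :: "real \<Rightarrow> ('w, 'x) family \<Rightarrow> bool" where
  "periodic_family T B \<longleftrightarrow> (\<forall>\<tau> \<omega>. B (\<tau> + T) \<omega> = B \<tau> \<omega>)"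


section \<open>Pullback dynamics\<close>

definition nonempty_family :: "('w, 'x) family \<Rightarrow> bool" where
  "nonempty_family D \<longleftrightarrow> (\<forall>\<tau> \<omega>. D \<tau> \<omega> \<noteq> {})"

definition inclusion_closed :: "('w, 'x) family set \<Rightarrow> bool" where
  "inclusion_closed \<D> \<longleftrightarrow>
     (\<forall>D\<in>\<D>. \<forall>D'. nonempty_family D' \<longrightarrow> (\<forall>\<tau> \<omega>. D' \<tau> \<omega> \<subseteq> D \<tau> \<omega>) \<longrightarrow> D' \<in> \<D>)"

definition omega_limit ::
    "(real \<Rightarrow> 'w \<Rightarrow> 'w) \<Rightarrow> ('w, 'x::topological_space) multi_map \<Rightarrow> ('w, 'x) family \<Rightarrow> ('w, 'x) family" where
  "omega_limit \<theta> \<Phi> B \<tau> \<omega> = (\<Inter>r\<in>{0..}. closure (\<Union>t\<in>{r..}. pullback \<theta> \<Phi> B t \<tau> \<omega>))"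

definition pullback_asymptotically_compact ::
    "(real \<Rightarrow> 'w \<Rightarrow> 'w) \<Rightarrow> ('w, 'x::topological_space) multi_map \<Rightarrow> ('w, 'x) family set \<Rightarrow> bool" where
  "pullback_asymptotically_compact \<theta> \<Phi> \<D> \<longleftrightarrow>
     (\<forall>\<tau> \<omega>. \<forall>D\<in>\<D>. \<forall>(t :: nat \<Rightarrow> real) x.
        (\<forall>n. 0 \<le> t n) \<longrightarrow> filterlim t at_top sequentially \<longrightarrow>
        (\<forall>n. x n \<in> pullback \<theta> \<Phi> D (t n) \<tau> \<omega>) \<longrightarrow>
        (\<exists>r :: nat \<Rightarrow> nat. strict_mono r \<and> convergent (x \<circ> r)))"

definition pullback_absorbing ::
    "(real \<Rightarrow> 'w \<Rightarrow> 'w) \<Rightarrow> ('w, 'x) multi_map \<Rightarrow> ('w, 'x) family set \<Rightarrow> ('w, 'x) family \<Rightarrow> bool" where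
  "pullback_absorbing \<theta> \<Phi> \<D> K \<longleftrightarrow>
     K \<in> \<D> \<and> (\<forall>\<tau> \<omega>. \<forall>D\<in>\<D>. \<exists>T>0. \<forall>t\<ge>T. pullback \<theta> \<Phi> D t \<tau> \<omega> \<subseteq> K \<tau> \<omega>)"

definition pullback_attractor ::
    "'w measure \<Rightarrow> (real \<Rightarrow> 'w \<Rightarrow> 'w) \<Rightarrow> ('w, 'x::metric_space) multi_map \<Rightarrow>
     ('w, 'x) family set \<Rightarrow> ('w, 'x) family \<Rightarrow> bool" where
  "pullback_attractor P \<theta> \<Phi> \<D> A \<longleftrightarrow>
     A \<in> \<D> \<and>
     (\<forall>\<tau>. multi_measurable P (A \<tau>)) \<and>
     (\<forall>\<tau> \<omega>. compact (A \<tau> \<omega>)) \<and>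
     (\<forall>\<tau> \<omega>. \<forall>t\<ge>0. multi_image \<Phi> t \<tau> \<omega> (A \<tau> \<omega>) = A (\<tau> + t) (\<theta> t \<omega>)) \<and>
     (\<forall>\<tau> \<omega>. \<forall>D\<in>\<D>.
        ((\<lambda>t. hausdorff_semidist (pullback \<theta> \<Phi> D t \<tau> \<omega>) (A \<tau> \<omega>)) \<longlongrightarrow> 0) at_top)"

end

theory Submission
  imports Defs
begin

text \<open>
  Asymptotic compactness and the absorbing family \<open>K\<close> make every limit point of pullback orbits
  of a family in \<open>\<D>\<close> lie in the limit set \<open>\<A>\<close> of \<open>K\<close>, and make every such orbit
  sequence have limit points. Attraction and compactness follow. Upper semicontinuity with closed
  values says that the cocycle has a closed graph in the state variable, which yields
  \<open>\<A>(\<tau> + t, \<theta>\<^sub>t \<omega>) \<subseteq> \<Phi>(t, \<tau>, \<omega>, \<A>(\<tau>, \<omega>))\<close> by pulling a limit point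
  back along the orbits that converge to it. The opposite inclusion would be proved for single-valued
  maps by continuity, but an upper semicontinuous multivalued map need not let one approximate a given
  image point by images of nearby points. Instead, the first inclusion is iterated: a point of
  \<open>\<Phi>(t, \<tau>, \<omega>, \<A>(\<tau>, \<omega>))\<close> lies in the pullback image of \<open>\<A>\<close> over every
  time \<open>t + s\<close>, hence it is a limit point of pullback orbits of \<open>\<A> \<in> \<D>\<close>
  (\<open>attr_invariant\<close>). Uniqueness holds because an invariant family equals its own pullback images
  at all times and each of two attractors attracts the other.

  The delicate part is measurability, since \<open>P\<close> need not be complete, so that projection theorems
  are not available. The inclusion above and \<open>\<A> \<subseteq> K\<close> put \<open>\<A>\<close> inside the pullback
  image \<open>G\<^sub>n\<close> of \<open>K\<close> over time \<open>n\<close>, for every \<open>n\<close>. Together with asymptotic compactness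
  this shows that a closed set \<open>C\<close> meets \<open>\<A>(\<tau>, \<omega>)\<close> if and only if it meets
  \<open>G\<^sub>n(\<tau>, \<omega>)\<close> for all \<open>n\<close> (\<open>attr_meets_closed_iff\<close>), a countable condition. For a
  closed ball \<open>C\<close>, weak upper semicontinuity makes the set of \<open>\<omega> \<in> \<Omega>\<^sub>m\<close> whose image
  meets \<open>C\<close> relatively closed in \<open>\<Omega>\<^sub>m\<close>, because closed balls are weakly closed
  (\<open>weakly_usc_cover_borel\<close>). Finally, separability writes an open set as a countable union of
  closed balls. That closed balls are weakly closed is the only place for the Hahn-Banach theorem, in
  the form that every vector has a norming functional (\<open>norming_functional_exists\<close>).
\<close>

section \<open>Norming functionals and weak limits\<close>

text \<open>Homogeneity is required only as an inequality, which is easier to verify for infima and implies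
  the equality (\<open>sublinear_scale\<close>).\<close>

definition sublinear :: "('a::real_vector \<Rightarrow> real) \<Rightarrow> bool" where
  "sublinear p \<longleftrightarrow>
     (\<forall>x y. p (x + y) \<le> p x + p y) \<and> (\<forall>c x. 0 \<le> c \<longrightarrow> p (c *\<^sub>R x) \<le> c * p x)"

lemma sublinear_add: "sublinear p \<Longrightarrow> p (x + y) \<le> p x + p y"
  by (simp add: sublinear_def)

lemma sublinear_zero: "sublinear p \<Longrightarrow> p 0 = 0"
proof -
  assume p: "sublinear p"
  have "p (0 *\<^sub>R 0) \<le> 0 * p 0" using p unfolding sublinear_def by blast
  moreover have "p (0 + 0) \<le> p 0 + p 0" using p by (rule sublinear_add)
  ultimately show ?thesis by simp
qed

lemma sublinear_scale:
  assumes p: "sublinear p" and c: "0 \<le> c"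
  shows "p (c *\<^sub>R x) = c * p x"
proof (cases "c = 0")
  case True
  then show ?thesis using sublinear_zero[OF p] by simp
next
  case False
  with c have c0: "0 < c" by simp
  have "p (inverse c *\<^sub>R (c *\<^sub>R x)) \<le> inverse c * p (c *\<^sub>R x)"
    using p c0 unfolding sublinear_def by (meson inverse_nonnegative_iff_nonnegative less_imp_le)
  then have "c * p x \<le> p (c *\<^sub>R x)" using c0 by (simp add: field_simps)
  moreover have "p (c *\<^sub>R x) \<le> c * p x" using p c unfolding sublinear_def by blast
  ultimately show ?thesis by simp
qed

lemma sublinear_lower: "sublinear p \<Longrightarrow> - p (- x) \<le> p x"
  using sublinear_add[of p x "- x"] sublinear_zero[of p] by simp

lemma sublinear_norm: "sublinear (norm :: 'a::real_normed_vector \<Rightarrow> real)"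
  by (simp add: sublinear_def norm_triangle_ineq)

lemma cINF_add_greatest:
  fixes f :: "'i \<Rightarrow> real" and g :: "'j \<Rightarrow> real"
  assumes "I \<noteq> {}" "J \<noteq> {}" and le: "\<And>i j. i \<in> I \<Longrightarrow> j \<in> J \<Longrightarrow> L \<le> f i + g j"
  shows "L \<le> (INF i\<in>I. f i) + (INF j\<in>J. g j)"
proof -
  have "L - (INF j\<in>J. g j) \<le> f i" if i: "i \<in> I" for i
  proof -
    have "L - f i \<le> (INF j\<in>J. g j)"
      using assms i by (intro cINF_greatest) (auto simp: algebra_simps)
    then show ?thesis by simp
  qed
  then have "L - (INF j\<in>J. g j) \<le> (INF i\<in>I. f i)"
    using assms by (intro cINF_greatest) auto
  then show ?thesis by simp
qed

text \<open>The largest sublinear functional below \<open>p\<close> that also satisfies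
  \<open>tilt p v (- v) \<le> - p v\<close>; it is the device that
  turns minimality of a sublinear functional into additivity.\<close>

definition tilt :: "('a::real_vector \<Rightarrow> real) \<Rightarrow> 'a \<Rightarrow> 'a \<Rightarrow> real" where
  "tilt p v x = (INF t\<in>{0..}. p (x + t *\<^sub>R v) - t * p v)"

lemma tilt_le:
  assumes p: "sublinear p" and t: "0 \<le> t"
  shows "tilt p v x \<le> p (x + t *\<^sub>R v) - t * p v"
  unfolding tilt_def
proof (rule cINF_lower)
  have "- p (- x) \<le> p (x + s *\<^sub>R v) - s * p v" if "0 \<le> s" for s
  proof -
    have "p (s *\<^sub>R v) \<le> p (x + s *\<^sub>R v) + p (- x)"
      using sublinear_add[OF p, of "x + s *\<^sub>R v" "- x"] by simp
    then show ?thesis using sublinear_scale[OF p that, of v] by simp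
  qed
  then show "bdd_below ((\<lambda>t. p (x + t *\<^sub>R v) - t * p v) ` {0..})"
    by (intro bdd_belowI2[where m = "- p (- x)"]) auto
qed (use t in auto)

lemma sublinear_tilt:
  assumes p: "sublinear p"
  shows "sublinear (tilt p v)"
  unfolding sublinear_def
proof (intro conjI allI impI)
  fix x y
  show "tilt p v (x + y) \<le> tilt p v x + tilt p v y"
    unfolding tilt_def[of p v x] tilt_def[of p v y]
  proof (rule cINF_add_greatest)
    fix s t :: real assume "s \<in> {0..}" "t \<in> {0..}"
    then have st: "0 \<le> s + t" by simp
    have "tilt p v (x + y) \<le> p (x + y + (s + t) *\<^sub>R v) - (s + t) * p v"
      using tilt_le[OF p st] .
    also have "\<dots> \<le> p (x + s *\<^sub>R v) - s * p v + (p (y + t *\<^sub>R v) - t * p v)"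
      using sublinear_add[OF p, of "x + s *\<^sub>R v" "y + t *\<^sub>R v"] by (simp add: algebra_simps)
    finally show "tilt p v (x + y) \<le> p (x + s *\<^sub>R v) - s * p v + (p (y + t *\<^sub>R v) - t * p v)" .
  qed auto
next
  fix c :: real and x assume c: "0 \<le> c"
  show "tilt p v (c *\<^sub>R x) \<le> c * tilt p v x"
  proof (cases "c = 0")
    case True
    then show ?thesis using tilt_le[OF p, of 0 v 0] sublinear_zero[OF p] by simp
  next
    case False
    with c have c0: "0 < c" by simp
    have "tilt p v (c *\<^sub>R x) / c \<le> tilt p v x"
      unfolding tilt_def[of p v x]
    proof (rule cINF_greatest)
      fix t :: real assume "t \<in> {0..}"
      then have ct: "0 \<le> c * t" using c by simp
      have "tilt p v (c *\<^sub>R x) \<le> p (c *\<^sub>R x + (c * t) *\<^sub>R v) - (c * t) * p v"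
        using tilt_le[OF p ct] .
      also have "\<dots> = c * (p (x + t *\<^sub>R v) - t * p v)"
        using sublinear_scale[OF p c, of "x + t *\<^sub>R v"] by (simp add: algebra_simps)
      finally show "tilt p v (c *\<^sub>R x) / c \<le> p (x + t *\<^sub>R v) - t * p v"
        using c0 by (simp add: field_simps)
    qed auto
    then show ?thesis using c0 by (simp add: field_simps)
  qed
qed

text \<open>Along a chain, two values \<open>p x\<close> and \<open>q y\<close> can be bounded below by values of a single member,
  so subadditivity passes to the infimum. The common bound \<open>b\<close> keeps the infimum finite, through
  \<open>p x \<ge> - p (- x) \<ge> - b (- x)\<close>.\<close>

lemma sublinear_INF_chain:
  fixes C :: "('a::real_vector \<Rightarrow> real) set"
  assumes ne: "C \<noteq> {}" and sub: "\<And>p. p \<in> C \<Longrightarrow> sublinear p"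
    and bound: "\<And>p. p \<in> C \<Longrightarrow> p \<le> b"
    and chain: "\<And>p q. p \<in> C \<Longrightarrow> q \<in> C \<Longrightarrow> p \<le> q \<or> q \<le> p"
  shows "sublinear (\<lambda>x. INF p\<in>C. p x)" and "p \<in> C \<Longrightarrow> (INF p\<in>C. p x) \<le> p x"
proof -
  have lower: "(INF p\<in>C. p x) \<le> p x" if "p \<in> C" for p x
  proof (rule cINF_lower)
    have "- b (- x) \<le> q x" if "q \<in> C" for q
      using sublinear_lower[OF sub[OF that], of x] le_funD[OF bound[OF that], of "- x"] by simp
    then show "bdd_below ((\<lambda>p. p x) ` C)"
      by (intro bdd_belowI2[where m = "- b (- x)"]) auto
  qed (fact that)
  then show "p \<in> C \<Longrightarrow> (INF p\<in>C. p x) \<le> p x" .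
  show "sublinear (\<lambda>x. INF p\<in>C. p x)"
    unfolding sublinear_def
  proof (intro conjI allI impI)
    fix x y
    show "(INF p\<in>C. p (x + y)) \<le> (INF p\<in>C. p x) + (INF p\<in>C. p y)"
    proof (rule cINF_add_greatest[OF ne ne])
      fix p q assume pq: "p \<in> C" "q \<in> C"
      then obtain r where r: "r \<in> C" "r \<le> p" "r \<le> q"
        using chain[of p q] by auto
      show "(INF p\<in>C. p (x + y)) \<le> p x + q y"
        using lower[OF r(1), of "x + y"] sublinear_add[OF sub[OF r(1)], of x y]
          le_funD[OF r(2), of x] le_funD[OF r(3), of y] by linarith
    qed
  next
    fix c :: real and x assume c: "0 \<le> c"
    show "(INF p\<in>C. p (c *\<^sub>R x)) \<le> c * (INF p\<in>C. p x)"
    proof (cases "c = 0")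
      case True
      obtain p where p: "p \<in> C" using ne by auto
      then show ?thesis
        using True lower[OF p, of 0] sublinear_zero[OF sub[OF p]] by simp
    next
      case False
      with c have c0: "0 < c" by simp
      have "(INF p\<in>C. p (c *\<^sub>R x)) / c \<le> (INF p\<in>C. p x)"
      proof (rule cINF_greatest[OF ne])
        fix p assume p: "p \<in> C"
        show "(INF p\<in>C. p (c *\<^sub>R x)) / c \<le> p x"
          using lower[OF p, of "c *\<^sub>R x"] sublinear_scale[OF sub[OF p] c, of x] c0
          by (simp add: field_simps)
      qed
      then show ?thesis using c0 by (simp add: field_simps)
    qed
  qed
qed

lemma minimal_sublinear_exists:
  assumes b: "sublinear b"
  obtains q where "sublinear q" "q \<le> b" "\<And>p. sublinear p \<Longrightarrow> p \<le> q \<Longrightarrow> p = q"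
proof -
  define S where "S = {p. sublinear p \<and> p \<le> b}"
  have "\<exists>m\<in>S. \<forall>a\<in>S. a \<le> m \<longrightarrow> a = m"
  proof (rule predicate_Zorn)
    show "partial_order_on S (relation_of (\<lambda>p q. q \<le> p) S)"
      by (rule partial_order_on_relation_ofI) auto
    fix C assume C: "C \<in> Chains (relation_of (\<lambda>p q. q \<le> p) S)"
    then have CS: "p \<in> S" if "p \<in> C" for p
      using that by (auto simp: Chains_def relation_of_def)
    have chain: "p \<le> q \<or> q \<le> p" if "p \<in> C" "q \<in> C" for p q
      using C that by (auto simp: Chains_def relation_of_def)
    show "\<exists>u\<in>S. \<forall>p\<in>C. u \<le> p"
    proof (cases "C = {}")
      case True
      then show ?thesis using b by (auto simp: S_def)
    next
      case False
      then obtain p0 where p0: "p0 \<in> C" by auto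
      let ?u = "\<lambda>x. INF p\<in>C. p x"
      have sub: "sublinear ?u" and le: "\<And>p x. p \<in> C \<Longrightarrow> ?u x \<le> p x"
        using sublinear_INF_chain[of C b] False CS chain unfolding S_def by auto
      have "?u \<le> p" if "p \<in> C" for p
        using le[OF that] by (auto intro: le_funI)
      moreover from this[OF p0] have "?u \<le> b"
        using CS[OF p0] by (auto simp: S_def intro: order_trans)
      ultimately show ?thesis using sub by (intro bexI[of _ ?u]) (auto simp: S_def)
    qed
  qed
  then obtain q where q: "q \<in> S" and qmin: "\<And>p. p \<in> S \<Longrightarrow> p \<le> q \<Longrightarrow> p = q" by blast
  show thesis
  proof (rule that)
    fix p assume "sublinear p" "p \<le> q"
    then show "p = q" using q by (intro qmin) (auto simp: S_def intro: order_trans)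
  qed (use q in \<open>auto simp: S_def\<close>)
qed

text \<open>Minimality forces \<open>tilt q y = q\<close>; evaluating the infimum that defines the tilt at parameter 1
  gives \<open>q x \<le> q (x + y) - q y\<close>, the reverse of subadditivity.\<close>

lemma minimal_sublinear_linear:
  fixes q :: "'a::real_vector \<Rightarrow> real"
  assumes q: "sublinear q" and qmin: "\<And>p. sublinear p \<Longrightarrow> p \<le> q \<Longrightarrow> p = q"
  shows "linear q"
proof -
  have add: "q (x + y) = q x + q y" for x y
  proof -
    have "tilt q y \<le> q" using tilt_le[OF q, of 0 y] by (auto intro!: le_funI)
    then have "tilt q y = q" using sublinear_tilt[OF q] by (intro qmin)
    then have "q x \<le> q (x + y) - q y" using tilt_le[OF q, of 1 y x] by simp
    then show ?thesis using sublinear_add[OF q, of x y] by simp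
  qed
  have minus: "q (- x) = - q x" for x
    using add[of x "- x"] sublinear_zero[OF q] by simp
  show ?thesis
  proof (rule linearI)
    fix c :: real and x
    show "q (c *\<^sub>R x) = c *\<^sub>R q x"
    proof (cases "0 \<le> c")
      case True
      then show ?thesis using sublinear_scale[OF q] by simp
    next
      case False
      then have "q ((- c) *\<^sub>R x) = (- c) * q x" by (intro sublinear_scale[OF q]) simp
      then show ?thesis using minus[of "c *\<^sub>R x"] by simp
    qed
  qed (rule add)
qed

text \<open>A minimal sublinear functional below the norm is a linear functional bounded by 1. Starting
  from the tilted norm instead of the norm forces the value at \<open>v\<close> to be as large as possible.\<close>

lemma norming_functional_exists:
  fixes v :: "'a::real_normed_vector"
  obtains f :: "'a \<Rightarrow> real" where "bounded_linear f" "f v = norm v" "\<And>x. f x \<le> norm x"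
proof -
  obtain q where q: "sublinear q" "q \<le> tilt norm v"
    and qmin: "\<And>p. sublinear p \<Longrightarrow> p \<le> q \<Longrightarrow> p = q"
    using minimal_sublinear_exists[OF sublinear_tilt[OF sublinear_norm]] by metis
  interpret linear q using q(1) qmin by (rule minimal_sublinear_linear)
  have le: "q x \<le> norm x" for x
    using le_funD[OF q(2), of x] tilt_le[OF sublinear_norm, of 0 v x] by simp
  have "norm (q x) \<le> norm x * 1" for x
    using le[of x] le[of "- x"] by (simp add: neg)
  then have "bounded_linear q" by (intro bounded_linear_intro[where K = 1]) (auto simp: add scale)
  moreover have "q v = norm v"
    \<comment> \<open>The parameter 1 in the tilt gives q (- v) \<open>\<le>\<close> norm 0 - norm v.\<close>
    using le[of v] le_funD[OF q(2), of "- v"] tilt_le[OF sublinear_norm, of 1 v "- v"]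
    by (simp add: neg)
  ultimately show thesis using le that by blast
qed

text \<open>A functional that norms \<open>x0 - a\<close> is bounded by \<open>r\<close> along \<open>x - a\<close>, and it sees the weak
  limit.\<close>

lemma cball_weakly_closed:
  assumes x: "weakly_tendsto x x0" and ball: "\<And>n. x n \<in> cball a r"
  shows "x0 \<in> cball a r"
proof -
  obtain f :: "'a \<Rightarrow> real" where f: "bounded_linear f" "f (x0 - a) = norm (x0 - a)"
    and le: "\<And>y. f y \<le> norm y"
    using norming_functional_exists by metis
  interpret bounded_linear f by (fact f(1))
  have "(\<lambda>n. f (x n)) \<longlonglongrightarrow> f x0" using x f(1) unfolding weakly_tendsto_def by blast
  moreover have "f (x n) \<le> f a + r" for n
    using le[of "x n - a"] ball[of n] by (simp add: diff dist_norm norm_minus_commute)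
  ultimately have "f x0 \<le> f a + r" by (intro LIMSEQ_le_const2) auto
  then show ?thesis using f(2) by (simp add: diff dist_norm norm_minus_commute)
qed

section \<open>Measurability of multivalued maps\<close>

lemma weakly_usc_on_closed_preimage:
  assumes G: "weakly_usc_on S G"
  shows "closedin (top_of_set S) {y \<in> S. G y \<inter> cball a r \<noteq> {}}"
proof -
  let ?W = "{y \<in> S. G y \<inter> cball a r \<noteq> {}}"
  have limit: "z \<in> ?W" if z: "z \<in> S" and y: "\<And>n. y n \<in> ?W" and lim: "y \<longlonglongrightarrow> z" for y z
  proof -
    have "\<forall>n. \<exists>u. u \<in> G (y n) \<and> u \<in> cball a r" using y by blast
    then obtain x where x: "\<And>n. x n \<in> G (y n)" "\<And>n. x n \<in> cball a r" by metis
    have "\<exists>x0\<in>G z. \<exists>k :: nat \<Rightarrow> nat. strict_mono k \<and> weakly_tendsto (x \<circ> k) x0"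
      using G z y lim x(1) unfolding weakly_usc_on_def by blast
    then obtain x0 k where x0: "x0 \<in> G z" "weakly_tendsto (x \<circ> k) x0" by blast
    moreover have "x0 \<in> cball a r"
      using x(2) by (intro cball_weakly_closed[OF x0(2)]) simp
    ultimately show ?thesis using z by blast
  qed
  have "S \<inter> closure ?W \<subseteq> ?W"
  proof
    fix z assume z: "z \<in> S \<inter> closure ?W"
    then have "z \<in> closure ?W" by (rule IntD2)
    then obtain y where y: "(\<forall>n. y n \<in> ?W) \<and> y \<longlonglongrightarrow> z"
      unfolding closure_sequential by (rule exE)
    show "z \<in> ?W"
      by (rule limit[OF IntD1[OF z] conjunct1[OF y, rule_format] conjunct2[OF y]])
  qed
  moreover have "?W \<subseteq> S \<inter> closure ?W"
    using closure_subset[of ?W] by (intro Int_greatest) auto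
  ultimately have "?W = S \<inter> closure ?W" by (rule equalityI[rotated])
  then show ?thesis unfolding closedin_closed by blast
qed

lemma weakly_usc_cover_borel:
  fixes \<Omega>\<^sub>m :: "nat \<Rightarrow> 'w::metric_space set"
  assumes cover: "(\<Union>m\<in>{1..}. \<Omega>\<^sub>m m) = UNIV"
    and meas: "\<And>m. m \<ge> 1 \<Longrightarrow> \<Omega>\<^sub>m m \<in> sets borel"
    and weak: "\<And>m. m \<ge> 1 \<Longrightarrow> weakly_usc_on (\<Omega>\<^sub>m m) G"
  shows "{\<omega>. G \<omega> \<inter> cball a r \<noteq> {}} \<in> sets borel"
proof -
  have "{\<omega> \<in> \<Omega>\<^sub>m m. G \<omega> \<inter> cball a r \<noteq> {}} \<in> sets borel" if m: "m \<ge> 1" for m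
  proof -
    obtain T where "closed T" "{\<omega> \<in> \<Omega>\<^sub>m m. G \<omega> \<inter> cball a r \<noteq> {}} = \<Omega>\<^sub>m m \<inter> T"
      using weakly_usc_on_closed_preimage[OF weak[OF m]] unfolding closedin_closed by blast
    then show ?thesis using meas[OF m] by (simp add: borel_closed sets.Int)
  qed
  then have "(\<Union>m\<in>{1..}. {\<omega> \<in> \<Omega>\<^sub>m m. G \<omega> \<inter> cball a r \<noteq> {}}) \<in> sets borel"
    by (intro sets.countable_UN') auto
  moreover have "(\<Union>m\<in>{1..}. {\<omega> \<in> \<Omega>\<^sub>m m. G \<omega> \<inter> cball a r \<noteq> {}}) = {\<omega>. G \<omega> \<inter> cball a r \<noteq> {}}"
    using cover by blast
  ultimately show ?thesis by simp
qed

lemma open_countable_Union_cball: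
  fixes U :: "'x::{metric_space, second_countable_topology} set"
  assumes "open U"
  obtains I :: "('x \<times> real) set" where "countable I" "U = (\<Union>(a, r)\<in>I. cball a r)"
proof -
  obtain D :: "'x set" where D: "countable D"
    and dense: "\<And>V. open V \<Longrightarrow> V \<noteq> {} \<Longrightarrow> \<exists>d\<in>D. d \<in> V"
    using countable_dense_setE by blast
  let ?I = "{(a, r) \<in> D \<times> \<rat>. cball a r \<subseteq> U}"
  show thesis
  proof (rule that[of ?I])
    show "countable ?I"
      by (rule countable_subset[of _ "D \<times> \<rat>"]) (auto intro: D countable_rat)
    show "U = (\<Union>(a, r)\<in>?I. cball a r)"
    proof (intro equalityI subsetI)
      fix x assume "x \<in> U"
      then obtain e where e: "e > 0" "ball x e \<subseteq> U"
        using assms open_contains_ball by blast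
      obtain r where r: "r \<in> \<rat>" "0 < r" "r < e / 2"
        using Rats_dense_in_real[of 0 "e / 2"] e by auto
      obtain a where a: "a \<in> D" "a \<in> ball x r"
        using dense[of "ball x r"] r by auto
      have "cball a r \<subseteq> U"
      proof
        fix y assume "y \<in> cball a r"
        then have "dist x y < e"
          using a(2) r(3) dist_triangle[of x y a] by simp
        then show "y \<in> U" using e(2) by auto
      qed
      then show "x \<in> (\<Union>(a, r)\<in>?I. cball a r)"
        using a r by (intro UN_I[of "(a, r)"]) (auto simp: dist_commute)
    qed auto
  qed
qed

text \<open>Closed balls are the sets whose preimages weak upper semicontinuity controls, whereas
  measurability asks for preimages of open sets.\<close>

lemma multi_measurable_cballI:
  fixes G :: "'y \<Rightarrow> 'x::{metric_space, second_countable_topology} set"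
  assumes "\<And>a r. {y \<in> space M. G y \<inter> cball a r \<noteq> {}} \<in> sets M"
  shows "multi_measurable M G"
  unfolding multi_measurable_def
proof (intro allI impI)
  fix U :: "'x set" assume "open U"
  then obtain I :: "('x \<times> real) set" where I: "countable I" "U = (\<Union>(a, r)\<in>I. cball a r)"
    by (rule open_countable_Union_cball)
  have "(\<Union>i\<in>I. {y \<in> space M. G y \<inter> cball (fst i) (snd i) \<noteq> {}}) \<in> sets M"
    using I(1) assms by (intro sets.countable_UN') auto
  also have "(\<Union>i\<in>I. {y \<in> space M. G y \<inter> cball (fst i) (snd i) \<noteq> {}})
      = {y \<in> space M. G y \<inter> U \<noteq> {}}"
    unfolding I(2) by fastforce
  finally show "{y \<in> space M. G y \<inter> U \<noteq> {}} \<in> sets M" .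
qed

lemma metric_dynamical_system_measurable:
  assumes mds: "metric_dynamical_system P \<theta>"
  shows "\<theta> t \<in> P \<rightarrow>\<^sub>M P"
proof -
  have "(\<lambda>(t, \<omega>). \<theta> t \<omega>) \<circ> Pair t \<in> P \<rightarrow>\<^sub>M P"
    using mds unfolding metric_dynamical_system_def
    by (intro measurable_comp[of _ _ "borel \<Otimes>\<^sub>M P"]) auto
  then show ?thesis by (simp add: comp_def)
qed

section \<open>Dynamics of the limit set\<close>

lemma upper_semicontinuous_closed_graph:
  fixes G :: "'y::metric_space \<Rightarrow> 'x::metric_space set"
  assumes G: "upper_semicontinuous G" and cl: "closed (G z)"
    and z: "zs \<longlonglongrightarrow> z" and y: "ys \<longlonglongrightarrow> y" and mem: "\<And>n. ys n \<in> G (zs n)"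
  shows "y \<in> G z"
proof (rule ccontr)
  assume "y \<notin> G z"
  then obtain e where e: "e > 0" "ball y e \<subseteq> - G z"
    using cl open_contains_ball[of "- G z"] by auto
  let ?U = "- cball y (e / 2)"
  have "cball y (e / 2) \<subseteq> ball y e" using e(1) by auto
  then have "G z \<subseteq> interior ?U" using e(2) by (subst interior_open) auto
  then obtain h where h: "h > 0" "\<And>z'. dist z' z < h \<Longrightarrow> G z' \<subseteq> ?U"
    using G unfolding upper_semicontinuous_def by blast
  have "eventually (\<lambda>n. dist (zs n) z < h \<and> dist (ys n) y < e / 2) sequentially"
    using tendstoD[OF z h(1)] tendstoD[OF y, of "e / 2"] e(1) by (simp add: eventually_conj)
  then obtain n where n: "dist (zs n) z < h" "dist (ys n) y < e / 2"
    using eventually_happens trivial_limit_sequentially by blast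
  then have "ys n \<in> ?U" using h(2) mem by blast
  then show False using n(2) by (simp add: dist_commute)
qed

lemma filterlim_at_top_real_le:
  assumes "\<And>n. real n \<le> t n"
  shows "filterlim t at_top sequentially"
  by (rule filterlim_at_top_mono[OF filterlim_real_sequentially]) (simp add: assms)

lemma tendsto_if_dist_inverse:
  fixes x y :: "nat \<Rightarrow> 'x::metric_space"
  assumes d: "\<And>n. dist (x n) (y n) < inverse (real (Suc n))" and y: "y \<longlonglongrightarrow> z"
  shows "x \<longlonglongrightarrow> z"
proof -
  have "(\<lambda>n. inverse (real (Suc n)) + dist (y n) z) \<longlonglongrightarrow> 0 + 0"
    using y by (intro tendsto_add LIMSEQ_inverse_real_of_nat) (simp add: tendsto_dist_iff[symmetric])
  moreover have "norm (dist (x n) z) \<le> inverse (real (Suc n)) + dist (y n) z" for n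
    using d[of n] dist_triangle[of "x n" z "y n"]
    unfolding real_norm_def abs_of_nonneg[OF zero_le_dist] by linarith
  ultimately have "(\<lambda>n. dist (x n) z) \<longlonglongrightarrow> 0"
    by (intro Lim_null_comparison[of "\<lambda>n. dist (x n) z"]) auto
  then show ?thesis by (simp add: tendsto_dist_iff[symmetric])
qed

text \<open>The hypotheses under which the limit set of \<open>K\<close> is compact, invariant and attracting,
  stated apart from measurability in \<open>\<omega>\<close>.\<close>

locale absorbed_cocycle =
  fixes \<theta> :: "real \<Rightarrow> 'w \<Rightarrow> 'w"
    and \<Phi> :: "('w, 'x::metric_space) multi_map"
    and \<D> :: "('w, 'x) family set"
    and K :: "('w, 'x) family"
  assumes flow_zero: "\<And>\<omega>. \<theta> 0 \<omega> = \<omega>"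
    and flow_add: "\<And>t s \<omega>. \<theta> (t + s) \<omega> = \<theta> t (\<theta> s \<omega>)"
    and cocycle_nonempty: "\<And>t \<tau> \<omega> x. 0 \<le> t \<Longrightarrow> \<Phi> t \<tau> \<omega> x \<noteq> {}"
    and cocycle_closed: "\<And>t \<tau> \<omega> x. 0 \<le> t \<Longrightarrow> closed (\<Phi> t \<tau> \<omega> x)"
    and cocycle_add: "\<And>t s \<tau> \<omega> x. 0 \<le> t \<Longrightarrow> 0 \<le> s \<Longrightarrow>
          \<Phi> (t + s) \<tau> \<omega> x = multi_image \<Phi> t (\<tau> + s) (\<theta> s \<omega>) (\<Phi> s \<tau> \<omega> x)"
    and nonempty: "\<And>D. D \<in> \<D> \<Longrightarrow> nonempty_family D"
    and incl: "inclusion_closed \<D>"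
    and compactness: "pullback_asymptotically_compact \<theta> \<Phi> \<D>"
    and usc: "\<And>t \<tau> \<omega>. 0 \<le> t \<Longrightarrow> upper_semicontinuous (\<Phi> t \<tau> \<omega>)"
    and absorbing: "pullback_absorbing \<theta> \<Phi> \<D> K"
    and closed_K: "\<And>\<tau> \<omega>. closed (K \<tau> \<omega>)"
begin

abbreviation attr :: "('w, 'x) family" where
  "attr \<equiv> omega_limit \<theta> \<Phi> K"

lemma flow_cancel [simp]: "\<theta> s (\<theta> (- s) \<omega>) = \<omega>"
  using flow_add[of s "- s" \<omega>] by (simp add: flow_zero)

lemma multi_image_mono: "A \<subseteq> B \<Longrightarrow> multi_image \<Phi> t \<tau> \<omega> A \<subseteq> multi_image \<Phi> t \<tau> \<omega> B"
  unfolding multi_image_def by blast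

lemma multi_image_add:
  "0 \<le> t \<Longrightarrow> 0 \<le> s \<Longrightarrow>
     multi_image \<Phi> (t + s) \<tau> \<omega> A = multi_image \<Phi> t (\<tau> + s) (\<theta> s \<omega>) (multi_image \<Phi> s \<tau> \<omega> A)"
  unfolding multi_image_def by (simp add: cocycle_add multi_image_def)

lemma pullback_add:
  assumes "0 \<le> t" "0 \<le> s"
  shows "pullback \<theta> \<Phi> D (t + s) (\<tau> + t) (\<theta> t \<omega>) = multi_image \<Phi> t \<tau> \<omega> (pullback \<theta> \<Phi> D s \<tau> \<omega>)"
proof -
  have eq: "\<theta> (- (t + s)) (\<theta> t \<omega>) = \<theta> (- s) \<omega>"
    using flow_add[of "- (t + s)" t \<omega>] by simp
  show ?thesis
    unfolding pullback_def eq
    using multi_image_add[OF assms, of "\<tau> - s" "\<theta> (- s) \<omega>" "D (\<tau> - s) (\<theta> (- s) \<omega>)"]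
    by simp
qed

lemma pullback_split:
  assumes "0 \<le> s" "s \<le> t"
  shows "pullback \<theta> \<Phi> D t \<tau> \<omega>
    = multi_image \<Phi> s (\<tau> - s) (\<theta> (- s) \<omega>) (pullback \<theta> \<Phi> D (t - s) (\<tau> - s) (\<theta> (- s) \<omega>))"
  using pullback_add[of s "t - s" D "\<tau> - s" "\<theta> (- s) \<omega>"] assms by simp

lemma K_in: "K \<in> \<D>"
  using absorbing by (simp add: pullback_absorbing_def)

lemma pullback_nonempty: "D \<in> \<D> \<Longrightarrow> 0 \<le> t \<Longrightarrow> pullback \<theta> \<Phi> D t \<tau> \<omega> \<noteq> {}"
  using nonempty[of D] cocycle_nonempty[of t]
  by (simp add: pullback_def multi_image_def nonempty_family_def)

text \<open>By the cocycle property, a long pullback of \<open>D\<close> ends with a stretch of length \<open>s\<close>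
  before which the orbit has already been absorbed by \<open>K\<close>.\<close>

lemma eventually_pullback_subset:
  assumes D: "D \<in> \<D>" and s: "0 \<le> s"
  shows "\<exists>T\<ge>s. \<forall>t\<ge>T. pullback \<theta> \<Phi> D t \<tau> \<omega> \<subseteq> pullback \<theta> \<Phi> K s \<tau> \<omega>"
proof -
  obtain T where T: "T > 0"
    "\<And>t. t \<ge> T \<Longrightarrow> pullback \<theta> \<Phi> D t (\<tau> - s) (\<theta> (- s) \<omega>) \<subseteq> K (\<tau> - s) (\<theta> (- s) \<omega>)"
    using absorbing D unfolding pullback_absorbing_def by blast
  have "pullback \<theta> \<Phi> D t \<tau> \<omega> \<subseteq> pullback \<theta> \<Phi> K s \<tau> \<omega>" if t: "t \<ge> s + T" for t
  proof -
    have "pullback \<theta> \<Phi> D t \<tau> \<omega>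
      = multi_image \<Phi> s (\<tau> - s) (\<theta> (- s) \<omega>) (pullback \<theta> \<Phi> D (t - s) (\<tau> - s) (\<theta> (- s) \<omega>))"
      using s t T(1) by (intro pullback_split) auto
    also have "\<dots> \<subseteq> pullback \<theta> \<Phi> K s \<tau> \<omega>"
      unfolding pullback_def[of \<theta> \<Phi> K] using t by (intro multi_image_mono T(2)) simp
    finally show ?thesis .
  qed
  then show ?thesis using T(1) by (intro exI[of _ "s + T"]) auto
qed

lemma pullback_limit_in_attr:
  assumes D: "D \<in> \<D>" and t: "filterlim t at_top sequentially"
    and x: "\<And>n. x n \<in> pullback \<theta> \<Phi> D (t n) \<tau> \<omega>" and lim: "x \<longlonglongrightarrow> y"
  shows "y \<in> attr \<tau> \<omega>"
  unfolding omega_limit_def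
proof
  fix r :: real assume r: "r \<in> {0..}"
  then obtain T where T: "\<And>s. s \<ge> T \<Longrightarrow> pullback \<theta> \<Phi> D s \<tau> \<omega> \<subseteq> pullback \<theta> \<Phi> K r \<tau> \<omega>"
    using eventually_pullback_subset[OF D, of r \<tau> \<omega>] by auto
  have "eventually (\<lambda>n. T \<le> t n) sequentially"
    using t by (simp add: filterlim_at_top)
  then have "eventually (\<lambda>n. x n \<in> closure (\<Union>t\<in>{r..}. pullback \<theta> \<Phi> K t \<tau> \<omega>)) sequentially"
  proof eventually_elim
    case (elim n)
    then have "x n \<in> pullback \<theta> \<Phi> K r \<tau> \<omega>" using T x by blast
    then show ?case by (intro subsetD[OF closure_subset]) auto
  qed
  then show "y \<in> closure (\<Union>t\<in>{r..}. pullback \<theta> \<Phi> K t \<tau> \<omega>)"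
    by (rule Lim_in_closed_set[OF closed_closure _ trivial_limit_sequentially lim])
qed

lemma pullback_subseq_limit:
  assumes D: "D \<in> \<D>" and t: "filterlim t at_top sequentially" "\<And>n. 0 \<le> t n"
    and x: "\<And>n. x n \<in> pullback \<theta> \<Phi> D (t n) \<tau> \<omega>"
  obtains k y where "strict_mono (k :: nat \<Rightarrow> nat)" "(x \<circ> k) \<longlonglongrightarrow> y" "y \<in> attr \<tau> \<omega>"
proof -
  have "\<exists>k :: nat \<Rightarrow> nat. strict_mono k \<and> convergent (x \<circ> k)"
    using compactness D t x unfolding pullback_asymptotically_compact_def by blast
  then obtain k y where k: "strict_mono (k :: nat \<Rightarrow> nat)" "(x \<circ> k) \<longlonglongrightarrow> y"
    by (auto simp: convergent_def)
  have "filterlim (\<lambda>n. t (k n)) at_top sequentially"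
    using t(1) filterlim_subseq[OF k(1)] by (rule filterlim_compose)
  then have "y \<in> attr \<tau> \<omega>"
    using x k(2) by (intro pullback_limit_in_attr[OF D, of "\<lambda>n. t (k n)" "x \<circ> k"]) auto
  with k show thesis by (rule that)
qed

lemma attr_approx:
  assumes y: "y \<in> attr \<tau> \<omega>" and e: "0 < e" and r: "0 \<le> r"
  shows "\<exists>t\<ge>r. \<exists>x\<in>pullback \<theta> \<Phi> K t \<tau> \<omega>. dist x y < e"
proof -
  have "y \<in> closure (\<Union>t\<in>{r..}. pullback \<theta> \<Phi> K t \<tau> \<omega>)"
    using y r unfolding omega_limit_def by auto
  then have "\<exists>x\<in>\<Union>t\<in>{r..}. pullback \<theta> \<Phi> K t \<tau> \<omega>. dist x y < e"
    using e unfolding closure_approachable by simp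
  then show ?thesis by auto
qed

text \<open>A point of the limit set at the later time is a limit of points of \<open>\<Phi> t \<tau> \<omega> (z n)\<close> with
  \<open>z n\<close> in pullback images of \<open>K\<close> at the earlier time; a limit point of the \<open>z n\<close> is a preimage
  because the graph is closed.\<close>

lemma attr_subset_image: "0 \<le> t \<Longrightarrow> attr (\<tau> + t) (\<theta> t \<omega>) \<subseteq> multi_image \<Phi> t \<tau> \<omega> (attr \<tau> \<omega>)"
proof
  fix y assume t: "0 \<le> t" and y: "y \<in> attr (\<tau> + t) (\<theta> t \<omega>)"
  have "\<exists>s x z. real n \<le> s \<and> z \<in> pullback \<theta> \<Phi> K s \<tau> \<omega> \<and> x \<in> \<Phi> t \<tau> \<omega> z
      \<and> dist x y < inverse (real (Suc n))" for n
  proof -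
    obtain s x where s: "t + real n \<le> s" and x: "x \<in> pullback \<theta> \<Phi> K s (\<tau> + t) (\<theta> t \<omega>)"
      "dist x y < inverse (real (Suc n))"
      using t attr_approx[OF y, of "inverse (real (Suc n))" "t + real n"] by auto
    have "pullback \<theta> \<Phi> K s (\<tau> + t) (\<theta> t \<omega>) = multi_image \<Phi> t \<tau> \<omega> (pullback \<theta> \<Phi> K (s - t) \<tau> \<omega>)"
      using pullback_add[OF t, of "s - t"] s by simp
    then obtain z where "z \<in> pullback \<theta> \<Phi> K (s - t) \<tau> \<omega>" "x \<in> \<Phi> t \<tau> \<omega> z"
      using x(1) unfolding multi_image_def by blast
    then show ?thesis using s x(2) by (intro exI[of _ "s - t"] exI[of _ x] exI[of _ z]) auto
  qed
  then obtain s x z where s: "\<And>n. real n \<le> s n" and z: "\<And>n. z n \<in> pullback \<theta> \<Phi> K (s n) \<tau> \<omega>"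
    and x: "\<And>n. x n \<in> \<Phi> t \<tau> \<omega> (z n)" and d: "\<And>n. dist (x n) y < inverse (real (Suc n))"
    by metis
  have s0: "0 \<le> s n" for n using s[of n] by simp
  obtain k z0 where k: "strict_mono k" "(z \<circ> k) \<longlonglongrightarrow> z0" and z0: "z0 \<in> attr \<tau> \<omega>"
    using pullback_subseq_limit[OF K_in filterlim_at_top_real_le[OF s] s0 z] by blast
  have "x \<longlonglongrightarrow> y" using d by (intro tendsto_if_dist_inverse[OF _ tendsto_const])
  then have "(x \<circ> k) \<longlonglongrightarrow> y" using k(1) by (rule LIMSEQ_subseq_LIMSEQ)
  then have "y \<in> \<Phi> t \<tau> \<omega> z0"
    using upper_semicontinuous_closed_graph[OF usc cocycle_closed k(2)] t x by simp
  then show "y \<in> multi_image \<Phi> t \<tau> \<omega> (attr \<tau> \<omega>)"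
    using z0 unfolding multi_image_def by blast
qed

lemma attr_subset_pullback_attr: "0 \<le> t \<Longrightarrow> attr \<tau> \<omega> \<subseteq> pullback \<theta> \<Phi> attr t \<tau> \<omega>"
  using attr_subset_image[of t "\<tau> - t" "\<theta> (- t) \<omega>"]
  by (simp add: pullback_def)

lemma attr_subset_K: "attr \<tau> \<omega> \<subseteq> K \<tau> \<omega>"
proof -
  obtain T where T: "T > 0" "\<And>t. t \<ge> T \<Longrightarrow> pullback \<theta> \<Phi> K t \<tau> \<omega> \<subseteq> K \<tau> \<omega>"
    using absorbing K_in unfolding pullback_absorbing_def by blast
  have "attr \<tau> \<omega> \<subseteq> closure (\<Union>t\<in>{T..}. pullback \<theta> \<Phi> K t \<tau> \<omega>)"
    unfolding omega_limit_def using T(1) by auto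
  also have "\<dots> \<subseteq> K \<tau> \<omega>"
    using T(2) by (intro closure_minimal closed_K) auto
  finally show ?thesis .
qed

lemma attr_subset_pullback_K: "0 \<le> t \<Longrightarrow> attr \<tau> \<omega> \<subseteq> pullback \<theta> \<Phi> K t \<tau> \<omega>"
  using attr_subset_pullback_attr[of t \<tau> \<omega>]
  unfolding pullback_def by (rule order_trans[OF _ multi_image_mono[OF attr_subset_K]])

text \<open>This reduces measurability of the limit set to that of countably many pullback images of
  \<open>K\<close>. The limit set lies in every such image; conversely, points of \<open>C\<close> in the images over
  times \<open>n\<close> accumulate at a point of the limit set.\<close>

lemma attr_meets_closed_iff:
  assumes C: "closed C"
  shows "attr \<tau> \<omega> \<inter> C \<noteq> {} \<longleftrightarrow> (\<forall>n::nat. pullback \<theta> \<Phi> K (real n) \<tau> \<omega> \<inter> C \<noteq> {})"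
proof
  assume "attr \<tau> \<omega> \<inter> C \<noteq> {}"
  then show "\<forall>n::nat. pullback \<theta> \<Phi> K (real n) \<tau> \<omega> \<inter> C \<noteq> {}"
    using attr_subset_pullback_K[of "real n" \<tau> \<omega> for n] by fastforce
next
  assume "\<forall>n::nat. pullback \<theta> \<Phi> K (real n) \<tau> \<omega> \<inter> C \<noteq> {}"
  then have "\<forall>n. \<exists>x. x \<in> pullback \<theta> \<Phi> K (real n) \<tau> \<omega> \<and> x \<in> C" by blast
  then obtain x where x: "\<And>n. x n \<in> pullback \<theta> \<Phi> K (real n) \<tau> \<omega>" "\<And>n. x n \<in> C" by metis
  obtain k y where "strict_mono k" "(x \<circ> k) \<longlonglongrightarrow> y" "y \<in> attr \<tau> \<omega>"
    using pullback_subseq_limit[OF K_in filterlim_real_sequentially _ x(1)] by auto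
  moreover have "y \<in> C"
    using closed_sequentially[OF C _ \<open>(x \<circ> k) \<longlonglongrightarrow> y\<close>] x(2) by simp
  ultimately show "attr \<tau> \<omega> \<inter> C \<noteq> {}" by blast
qed

lemma attr_in: "attr \<in> \<D>"
proof -
  have "attr \<tau> \<omega> \<noteq> {}" for \<tau> \<omega>
    using attr_meets_closed_iff[of UNIV \<tau> \<omega>] pullback_nonempty[OF K_in] by simp
  then have "nonempty_family attr" by (simp add: nonempty_family_def)
  then show ?thesis
    by (rule incl[unfolded inclusion_closed_def, rule_format, OF K_in _ attr_subset_K])
qed

lemma compact_attr: "compact (attr \<tau> \<omega>)"
  unfolding compact_eq_seq_compact_metric seq_compact_def
proof (intro allI impI)
  fix y :: "nat \<Rightarrow> 'x" assume y: "\<forall>n. y n \<in> attr \<tau> \<omega>"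
  have "\<exists>t x. real n \<le> t \<and> x \<in> pullback \<theta> \<Phi> K t \<tau> \<omega> \<and> dist (y n) x < inverse (real (Suc n))" for n
  proof -
    have yn: "y n \<in> attr \<tau> \<omega>" using y by blast
    have "0 < inverse (real (Suc n))" by simp
    from attr_approx[OF yn this, of "real n"] obtain t x
      where "real n \<le> t" "x \<in> pullback \<theta> \<Phi> K t \<tau> \<omega>" and d: "dist x (y n) < inverse (real (Suc n))"
      by auto
    moreover have "dist (y n) x < inverse (real (Suc n))"
      using d by (simp only: dist_commute)
    ultimately show ?thesis by blast
  qed
  then obtain t x where t: "\<And>n. real n \<le> t n" and x: "\<And>n. x n \<in> pullback \<theta> \<Phi> K (t n) \<tau> \<omega>"
    and d: "\<And>n. dist (y n) (x n) < inverse (real (Suc n))"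
    by metis
  have t0: "0 \<le> t n" for n using t[of n] by simp
  obtain k z where k: "strict_mono k" "(x \<circ> k) \<longlonglongrightarrow> z" "z \<in> attr \<tau> \<omega>"
    using pullback_subseq_limit[OF K_in filterlim_at_top_real_le[OF t] t0 x] by blast
  have "dist ((y \<circ> k) n) ((x \<circ> k) n) < inverse (real (Suc n))" for n
  proof -
    have "inverse (real (Suc (k n))) \<le> inverse (real (Suc n))"
      using strict_mono_imp_increasing[OF k(1), of n] by (intro le_imp_inverse_le) auto
    with d[of "k n"] show ?thesis unfolding comp_def by (rule less_le_trans)
  qed
  then have "(y \<circ> k) \<longlonglongrightarrow> z" using k(2) by (rule tendsto_if_dist_inverse)
  with k show "\<exists>l\<in>attr \<tau> \<omega>. \<exists>r. strict_mono r \<and> (y \<circ> r) \<longlonglongrightarrow> l" by blast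
qed

text \<open>The forward inclusion rests on the backward one: it places \<open>\<Phi> t \<tau> \<omega> (attr \<tau> \<omega>)\<close>
  inside arbitrarily long pullback images of \<open>attr\<close> itself, which belongs to \<open>\<D>\<close>.\<close>

lemma attr_invariant:
  assumes t: "0 \<le> t"
  shows "multi_image \<Phi> t \<tau> \<omega> (attr \<tau> \<omega>) = attr (\<tau> + t) (\<theta> t \<omega>)"
proof
  show "multi_image \<Phi> t \<tau> \<omega> (attr \<tau> \<omega>) \<subseteq> attr (\<tau> + t) (\<theta> t \<omega>)"
  proof
    fix y assume y: "y \<in> multi_image \<Phi> t \<tau> \<omega> (attr \<tau> \<omega>)"
    have mem: "y \<in> pullback \<theta> \<Phi> attr (t + real n) (\<tau> + t) (\<theta> t \<omega>)" for n
      using y multi_image_mono[OF attr_subset_pullback_attr[of "real n" \<tau> \<omega>], of t \<tau> \<omega>]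
      by (auto simp: pullback_add[OF t])
    have "filterlim (\<lambda>n. t + real n) at_top sequentially"
      using t by (intro filterlim_at_top_real_le) simp
    then show "y \<in> attr (\<tau> + t) (\<theta> t \<omega>)"
      using mem by (rule pullback_limit_in_attr[OF attr_in _ _ tendsto_const])
  qed
qed (rule attr_subset_image[OF t])

lemma eventually_pullback_near_attr:
  assumes D: "D \<in> \<D>" and e: "0 < e"
  shows "eventually (\<lambda>t. \<forall>x\<in>pullback \<theta> \<Phi> D t \<tau> \<omega>. \<exists>b\<in>attr \<tau> \<omega>. dist x b < e) at_top"
proof (rule ccontr)
  let ?Q = "\<lambda>t. \<forall>x\<in>pullback \<theta> \<Phi> D t \<tau> \<omega>. \<exists>b\<in>attr \<tau> \<omega>. dist x b < e"
  assume not: "\<not> eventually ?Q at_top"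
  have "\<exists>t x. real n \<le> t \<and> x \<in> pullback \<theta> \<Phi> D t \<tau> \<omega> \<and> (\<forall>b\<in>attr \<tau> \<omega>. e \<le> dist x b)" for n
  proof -
    have "\<exists>t\<ge>real n. \<not> ?Q t"
    proof (rule ccontr)
      assume "\<not> (\<exists>t\<ge>real n. \<not> ?Q t)"
      then have "?Q t" if "real n \<le> t" for t using that by metis
      then have "eventually ?Q at_top" by (rule eventually_at_top_linorderI)
      with not show False by (rule notE)
    qed
    then show ?thesis by (simp add: not_less) blast
  qed
  then obtain t x where t: "\<And>n. real n \<le> t n" and x: "\<And>n. x n \<in> pullback \<theta> \<Phi> D (t n) \<tau> \<omega>"
    and far: "\<And>n b. b \<in> attr \<tau> \<omega> \<Longrightarrow> e \<le> dist (x n) b"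
    by metis
  have t0: "0 \<le> t n" for n using t[of n] by simp
  obtain k y where k: "(x \<circ> k) \<longlonglongrightarrow> y" "y \<in> attr \<tau> \<omega>"
    using pullback_subseq_limit[OF D filterlim_at_top_real_le[OF t] t0 x] by blast
  obtain n where "dist ((x \<circ> k) n) y < e"
    using eventually_happens[OF tendstoD[OF k(1) e]] by auto
  then show False using far[OF k(2), of "k n"] by simp
qed

lemma attr_attracts:
  assumes D: "D \<in> \<D>"
  shows "((\<lambda>t. hausdorff_semidist (pullback \<theta> \<Phi> D t \<tau> \<omega>) (attr \<tau> \<omega>)) \<longlongrightarrow> 0) at_top"
proof (rule order_tendstoI)
  fix a :: ennreal assume "0 < a"
  then obtain c where c: "0 < c" "c < a" using dense by blast
  then have "c < \<top>" using less_le_trans top_greatest by blast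
  then obtain e where e: "c = ennreal e" "0 < e"
    using c(1) by (cases c) (auto simp: top_ennreal.rep_eq)
  show "eventually (\<lambda>t. hausdorff_semidist (pullback \<theta> \<Phi> D t \<tau> \<omega>) (attr \<tau> \<omega>) < a) at_top"
    using eventually_pullback_near_attr[OF D e(2), of \<tau> \<omega>]
  proof eventually_elim
    case (elim t)
    have "hausdorff_semidist (pullback \<theta> \<Phi> D t \<tau> \<omega>) (attr \<tau> \<omega>) \<le> c"
      unfolding hausdorff_semidist_def
    proof (rule SUP_least)
      fix x assume "x \<in> pullback \<theta> \<Phi> D t \<tau> \<omega>"
      then obtain b where "b \<in> attr \<tau> \<omega>" "dist x b < e" using elim by blast
      then show "(INF b\<in>attr \<tau> \<omega>. ennreal (dist x b)) \<le> c"
        unfolding e(1) by (intro INF_lower2[of b]) (auto intro: ennreal_leI)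
    qed
    then show ?case using c(2) by simp
  qed
qed simp

lemma pullback_attractor_unique:
  assumes A: "pullback_attractor P \<theta> \<Phi> \<D> A"
  shows "A = attr"
proof (intro ext)
  fix \<tau> \<omega>
  have A_in: "A \<in> \<D>" and clA: "closed (A \<tau> \<omega>)"
    and inv: "\<And>t \<tau> \<omega>. 0 \<le> t \<Longrightarrow> multi_image \<Phi> t \<tau> \<omega> (A \<tau> \<omega>) = A (\<tau> + t) (\<theta> t \<omega>)"
    and attracts: "((\<lambda>t. hausdorff_semidist (pullback \<theta> \<Phi> attr t \<tau> \<omega>) (A \<tau> \<omega>)) \<longlongrightarrow> 0) at_top"
    using A attr_in by (auto simp: pullback_attractor_def intro: compact_imp_closed)
  have pullback_self: "pullback \<theta> \<Phi> B t \<tau> \<omega> = B \<tau> \<omega>"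
    if "0 \<le> t" "\<And>t \<tau> \<omega>. 0 \<le> t \<Longrightarrow> multi_image \<Phi> t \<tau> \<omega> (B \<tau> \<omega>) = B (\<tau> + t) (\<theta> t \<omega>)" for B t
    using that(2)[OF that(1), of "\<tau> - t" "\<theta> (- t) \<omega>"]
    by (simp add: pullback_def)
  show "A \<tau> \<omega> = attr \<tau> \<omega>"
  proof
    show "A \<tau> \<omega> \<subseteq> attr \<tau> \<omega>"
    proof
      fix y assume "y \<in> A \<tau> \<omega>"
      then have "y \<in> pullback \<theta> \<Phi> A (real n) \<tau> \<omega>" for n
        using pullback_self[of "real n" A] inv by simp
      then show "y \<in> attr \<tau> \<omega>"
        by (rule pullback_limit_in_attr[OF A_in filterlim_real_sequentially _ tendsto_const])
    qed
    have "eventually (\<lambda>t. hausdorff_semidist (pullback \<theta> \<Phi> attr t \<tau> \<omega>) (A \<tau> \<omega>)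
        = hausdorff_semidist (attr \<tau> \<omega>) (A \<tau> \<omega>)) at_top"
      using eventually_ge_at_top[of 0] by eventually_elim (simp add: pullback_self attr_invariant)
    then have "((\<lambda>t::real. hausdorff_semidist (attr \<tau> \<omega>) (A \<tau> \<omega>)) \<longlongrightarrow> 0) at_top"
      using attracts by (simp add: filterlim_cong)
    then have dist0: "hausdorff_semidist (attr \<tau> \<omega>) (A \<tau> \<omega>) = 0"
      by (simp add: tendsto_const_iff)
    show "attr \<tau> \<omega> \<subseteq> A \<tau> \<omega>"
    proof
      fix y assume "y \<in> attr \<tau> \<omega>"
      then have "(INF b\<in>A \<tau> \<omega>. ennreal (dist y b)) \<le> 0"
        unfolding dist0[symmetric] hausdorff_semidist_def by (rule SUP_upper)
      then have "(INF b\<in>A \<tau> \<omega>. ennreal (dist y b)) < ennreal e" if "0 < e" for e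
        using that by (auto intro: le_less_trans)
      then have "\<exists>b\<in>A \<tau> \<omega>. dist b y < e" if "0 < e" for e
        using that by (force simp: INF_less_iff ennreal_less_iff dist_commute)
      then have "y \<in> closure (A \<tau> \<omega>)" by (auto simp: closure_approachable)
      then show "y \<in> A \<tau> \<omega>" using clA by simp
    qed
  qed
qed

end

lemma omega_limit_periodic:
  assumes "periodic_cocycle T \<Phi>" "periodic_family T K"
  shows "periodic_family T (omega_limit \<theta> \<Phi> K)"
proof -
  have "pullback \<theta> \<Phi> K t (\<tau> + T) \<omega> = pullback \<theta> \<Phi> K t \<tau> \<omega>" if t: "0 \<le> t" for t \<tau> \<omega>
  proof -
    have "\<tau> + T - t = (\<tau> - t) + T" by simp
    moreover have "K (\<tau> - t + T) \<omega>' = K (\<tau> - t) \<omega>'" for \<omega>'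
      using assms(2) unfolding periodic_family_def by blast
    moreover have "\<Phi> t (\<tau> - t + T) \<omega>' = \<Phi> t (\<tau> - t) \<omega>'" for \<omega>'
      using assms(1) t unfolding periodic_cocycle_def by (intro ext) simp
    ultimately show ?thesis
      unfolding pullback_def multi_image_def by (simp only:)
  qed
  then show ?thesis
    unfolding periodic_family_def omega_limit_def by simp
qed

theorem theorem2p14:
  fixes P :: "'w::metric_space measure"
    and \<theta> :: "real \<Rightarrow> 'w \<Rightarrow> 'w"
    and \<Omega>\<^sub>m :: "nat \<Rightarrow> 'w set"
    and \<Phi> :: "real \<Rightarrow> real \<Rightarrow> 'w \<Rightarrow> 'x::{banach, second_countable_topology} \<Rightarrow> 'x set"
    and \<D> :: "(real \<Rightarrow> 'w \<Rightarrow> 'x set) set"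
    and K :: "real \<Rightarrow> 'w \<Rightarrow> 'x set"
  assumes borel_P: "sets P = sets borel"
    and mds: "metric_dynamical_system P \<theta>"
    and cover: "(\<Union>m\<in>{1..}. \<Omega>\<^sub>m m) = UNIV"
    and cover_borel: "\<And>m. m \<ge> 1 \<Longrightarrow> \<Omega>\<^sub>m m \<in> sets borel"
    and nonempty: "\<And>D. D \<in> \<D> \<Longrightarrow> nonempty_family D"
    and incl: "inclusion_closed \<D>"
    and cocycle: "multivalued_cocycle P \<theta> \<Phi>"
    and compactness: "pullback_asymptotically_compact \<theta> \<Phi> \<D>"
    and usc: "\<And>t \<tau> \<omega>. t \<ge> 0 \<Longrightarrow> upper_semicontinuous (\<Phi> t \<tau> \<omega>)"
    and absorbing: "pullback_absorbing \<theta> \<Phi> \<D> K"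
    and closed_K: "\<And>\<tau> \<omega>. closed (K \<tau> \<omega>)"
    and weak_usc: "\<And>m t \<tau>. m \<ge> 1 \<Longrightarrow> t \<ge> 0 \<Longrightarrow>
        weakly_usc_on (\<Omega>\<^sub>m m) (\<lambda>\<omega>. multi_image \<Phi> t \<tau> \<omega> (K \<tau> \<omega>))"
  shows "pullback_attractor P \<theta> \<Phi> \<D> (omega_limit \<theta> \<Phi> K)
    \<and> (\<forall>A. pullback_attractor P \<theta> \<Phi> \<D> A \<longrightarrow> A = omega_limit \<theta> \<Phi> K)
    \<and> (\<forall>T>0. periodic_cocycle T \<Phi> \<and> periodic_family T K
          \<longrightarrow> periodic_family T (omega_limit \<theta> \<Phi> K))"
proof -
  interpret absorbed_cocycle \<theta> \<Phi> \<D> K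
    using mds cocycle nonempty incl compactness usc absorbing closed_K
    unfolding metric_dynamical_system_def multivalued_cocycle_def
    by unfold_locales auto
  have space_P: "space P = UNIV"
    using sets_eq_imp_space_eq[OF borel_P] by simp
  have "multi_measurable P (attr \<tau>)" for \<tau>
  proof (rule multi_measurable_cballI)
    fix a :: 'x and r :: real
    have "{\<omega>. pullback \<theta> \<Phi> K (real n) \<tau> \<omega> \<inter> cball a r \<noteq> {}} \<in> sets P" for n
    proof -
      let ?G = "\<lambda>\<omega>. multi_image \<Phi> (real n) (\<tau> - real n) \<omega> (K (\<tau> - real n) \<omega>)"
      have "{\<omega>. ?G \<omega> \<inter> cball a r \<noteq> {}} \<in> sets P"
        unfolding borel_P using cover cover_borel weak_usc[of _ "real n"]
        by (intro weakly_usc_cover_borel[of \<Omega>\<^sub>m]) auto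
      then have "\<theta> (- real n) -` {\<omega>. ?G \<omega> \<inter> cball a r \<noteq> {}} \<inter> space P \<in> sets P"
        by (rule measurable_sets[OF metric_dynamical_system_measurable[OF mds]])
      then show ?thesis by (simp add: space_P pullback_def vimage_def)
    qed
    then have "(\<Inter>n. {\<omega>. pullback \<theta> \<Phi> K (real n) \<tau> \<omega> \<inter> cball a r \<noteq> {}}) \<in> sets P"
      by (intro sets.countable_INT) auto
    moreover have "(\<Inter>n. {\<omega>. pullback \<theta> \<Phi> K (real n) \<tau> \<omega> \<inter> cball a r \<noteq> {}})
        = {\<omega> \<in> space P. attr \<tau> \<omega> \<inter> cball a r \<noteq> {}}"
      by (auto simp: space_P attr_meets_closed_iff[OF closed_cball])
    ultimately show "{\<omega> \<in> space P. attr \<tau> \<omega> \<inter> cball a r \<noteq> {}} \<in> sets P" by simp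
  qed
  then have "pullback_attractor P \<theta> \<Phi> \<D> attr"
    unfolding pullback_attractor_def
    using attr_in compact_attr attr_invariant attr_attracts by blast
  then show ?thesis
    using pullback_attractor_unique omega_limit_periodic by blast
qed

end
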